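(* Let the system $x_{k+1}=A(p_k)x_k+Bu_k$, $k\in\mathbb{N}$, be polytopic (with functions $\xi_i$ and matrices $A_i$, $i\in\mathcal{N}$). The system is poly-Q stabilizable if there exist matrices $\bar{S}_i\in\mathbb{S}^{n_x}$, $X_i\in\mathbb{R}^{n_x\times n_x}$ and $\bar{P}_i=\bar{S}_i^{-1}$, $i\in\mathcal{N}$, such that $$\begin{bmatrix} X_i+X_i^\top-A_i\bar{S}_iA_i^\top+BB^\top & \star\\ X_i & \bar{S}_j\end{bmatrix}\succ 0\quad\text{for all } i,j\in\mathcal{N}.$$ Moreover, in that case, with $P(\pi)=\sum_{i\in\mathcal{N}}\xi_i(\pi)\bar{P}_i$ and $S(\pi)=P^{-1}(\pi)$, the controller gain $$K(k,\bm{p})=-B^\top\big(S(p_{k+1})+BB^\top\big)^{-1}A(p_k),\quad k\in\mathbb{N},\ \bm{p}=\{p_k\}_{k\in\mathbb{N}}\in\mathcal{P},$$ renders the closed-loop system $x_{k+1}=(A(p_k)+BK(k,\bm{p}))x_k$ poly-QS with poly-QLF $V(\pi,x)=x^\top P(\pi)x$.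
   Context: Notation: $\mathbb{N}=\{0,1,2,\dots\}$; $\mathbb{S}^n$ is the set of symmetric $n\times n$ real matrices; $M\succ 0$ means $M$ is symmetric positive definite; $\star$ denotes the block completing a symmetric matrix; $P^{-1}(\pi)=(P(\pi))^{-1}$. Setting: $\mathbb{P}\subseteq\mathbb{R}^{n_p}$ is a known compact set, $A\colon\mathbb{P}\to\mathbb{R}^{n_x\times n_x}$, $B\in\mathbb{R}^{n_x\times n_u}$. $\mathcal{P}$ is the set of all sequences $\bm{p}=\{p_k\}_{k\in\mathbb{N}}$ with $p_k\in\mathbb{P}$ for all $k$. Let $\mathcal{N}=\{1,\dots,N\}$. Polytopic: the system is polytopic if there exist continuous functions $\xi_i\colon\mathbb{P}\to\mathbb{R}_{\geqslant 0}$, $i\in\mathcal{N}$, with $\sum_{i\in\mathcal{N}}\xi_i(\pi)=1$ for all $\pi\in\mathbb{P}$, and matrices $A_i\in\mathbb{R}^{n_x\times n_x}$, $i\in\mathcal{N}$, such that $A(\pi)=\sum_{i\in\mathcal{N}}\xi_i(\pi)A_i$ for all $\pi\in\mathbb{P}$. Poly-QS: a system $x_{k+1}=F(k,\bm{p})x_k$ with $F\colon\mathbb{N}\times\mathcal{P}\to\mathbb{R}^{n_x\times n_x}$ is poly-quadratically stable (poly-QS) if it admits a poly-quadratic Lyapunov function (poly-QLF), i.e., a function $V(\pi,x)=x^\top P(\pi)x$ with $P(\pi)=\sum_{i\in\mathcal{N}}\xi_i(\pi)\bar{P}_i$, $\bar{P}_i\in\mathbb{S}^{n_x}$ (with the same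 functions $\xi_i$ as for $A$), such that for some $a_1,a_2,a_3>0$: $a_1\|x\|^2\leqslant V(\pi,x)\leqslant a_2\|x\|^2$ for all $\pi\in\mathbb{P}$, $x\in\mathbb{R}^{n_x}$, and $V(p_{k+1},F(k,\bm{p})x)\leqslant V(p_k,x)-a_3\|x\|^2$ for all $k\in\mathbb{N}$, $\bm{p}\in\mathcal{P}$, $x\in\mathbb{R}^{n_x}$. Poly-Q stabilizability: with state feedback $u_k=K(k,\bm{p})x_k$, the closed-loop system is $x_{k+1}=(A(p_k)+BK(k,\bm{p}))x_k$. The system is poly-Q stabilizable if there exists a function $K\colon\mathbb{N}\times\mathcal{P}\to\mathbb{R}^{n_u\times n_x}$ that renders the closed-loop system poly-QS. *)

theory Defs
  imports "HOL-Analysis.Analysis"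
begin

definition sym_matrix :: "real^'n^'n \<Rightarrow> bool" where
  "sym_matrix M \<longleftrightarrow> transpose M = M"

definition pos_def :: "real^'n^'n \<Rightarrow> bool" where
  "pos_def M \<longleftrightarrow> sym_matrix M \<and> (\<forall>x. x \<noteq> 0 \<longrightarrow> x \<bullet> (M *v x) > 0)"

text \<open>\<open>block_matrix M11 M12 M21 M22\<close> has \<open>M11\<close>, \<open>M12\<close> as its upper and \<open>M21\<close>, \<open>M22\<close>
  as its lower blocks; \<open>Inl\<close> indexes the first block of rows (columns), \<open>Inr\<close> the second.\<close>

definition block_matrix ::
    "real^'c^'a \<Rightarrow> real^'d^'a \<Rightarrow> real^'c^'b \<Rightarrow> real^'d^'b \<Rightarrow> real^('c + 'd)^('a + 'b)" where
  "block_matrix M11 M12 M21 M22 = (\<chi> r c.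
     case r of
       Inl i \<Rightarrow> (case c of Inl j \<Rightarrow> M11 $ i $ j | Inr j \<Rightarrow> M12 $ i $ j)
     | Inr i \<Rightarrow> (case c of Inl j \<Rightarrow> M21 $ i $ j | Inr j \<Rightarrow> M22 $ i $ j))"

definition poly_comb ::
    "nat \<Rightarrow> (nat \<Rightarrow> real^'p \<Rightarrow> real) \<Rightarrow> (nat \<Rightarrow> real^'m^'n) \<Rightarrow> real^'p \<Rightarrow> real^'m^'n" where
  "poly_comb N \<xi> M \<pi> = (\<Sum>i\<in>{1..N}. \<xi> i \<pi> *\<^sub>R M i)"

definition param_seqs :: "(real^'p) set \<Rightarrow> (nat \<Rightarrow> real^'p) set" where
  "param_seqs \<PP> = {p. \<forall>k. p k \<in> \<PP>}"

definition polytopic_with ::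
    "(real^'p) set \<Rightarrow> (real^'p \<Rightarrow> real^'x^'x) \<Rightarrow> nat \<Rightarrow> (nat \<Rightarrow> real^'p \<Rightarrow> real)
      \<Rightarrow> (nat \<Rightarrow> real^'x^'x) \<Rightarrow> bool" where
  "polytopic_with \<PP> A N \<xi> Av \<longleftrightarrow>
     (\<forall>i\<in>{1..N}. continuous_on \<PP> (\<xi> i) \<and> (\<forall>\<pi>\<in>\<PP>. 0 \<le> \<xi> i \<pi>)) \<and>
     (\<forall>\<pi>\<in>\<PP>. (\<Sum>i\<in>{1..N}. \<xi> i \<pi>) = 1) \<and>
     (\<forall>\<pi>\<in>\<PP>. A \<pi> = poly_comb N \<xi> Av \<pi>)"

text \<open>\<open>poly_QLF \<PP> N \<xi> F V\<close>: \<open>V\<close> is a poly-quadratic Lyapunov function, with weights \<open>\<xi>\<close>,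
  for \<open>x (k+1) = F k p (x k)\<close>. Functions on \<open>\<PP>\<close> and on \<open>param_seqs \<PP>\<close> are represented by
  total functions, whose values elsewhere are irrelevant.\<close>

definition poly_QLF ::
    "(real^'p) set \<Rightarrow> nat \<Rightarrow> (nat \<Rightarrow> real^'p \<Rightarrow> real)
      \<Rightarrow> (nat \<Rightarrow> (nat \<Rightarrow> real^'p) \<Rightarrow> real^'x^'x) \<Rightarrow> (real^'p \<Rightarrow> real^'x \<Rightarrow> real) \<Rightarrow> bool" where
  "poly_QLF \<PP> N \<xi> F V \<longleftrightarrow>
     (\<exists>Pv. (\<forall>i\<in>{1..N}. sym_matrix (Pv i)) \<and>
           (\<forall>\<pi>\<in>\<PP>. \<forall>x. V \<pi> x = x \<bullet> (poly_comb N \<xi> Pv \<pi> *v x))) \<and>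
     (\<exists>a1>0. \<exists>a2>0. \<exists>a3>0.
        (\<forall>\<pi>\<in>\<PP>. \<forall>x. a1 * (norm x)\<^sup>2 \<le> V \<pi> x \<and> V \<pi> x \<le> a2 * (norm x)\<^sup>2) \<and>
        (\<forall>k. \<forall>p\<in>param_seqs \<PP>. \<forall>x.
           V (p (k + 1)) (F k p *v x) \<le> V (p k) x - a3 * (norm x)\<^sup>2))"

definition poly_QS ::
    "(real^'p) set \<Rightarrow> nat \<Rightarrow> (nat \<Rightarrow> real^'p \<Rightarrow> real)
      \<Rightarrow> (nat \<Rightarrow> (nat \<Rightarrow> real^'p) \<Rightarrow> real^'x^'x) \<Rightarrow> bool" where
  "poly_QS \<PP> N \<xi> F \<longleftrightarrow> (\<exists>V. poly_QLF \<PP> N \<xi> F V)"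

definition closed_loop ::
    "(real^'p \<Rightarrow> real^'x^'x) \<Rightarrow> real^'u^'x \<Rightarrow> (nat \<Rightarrow> (nat \<Rightarrow> real^'p) \<Rightarrow> real^'x^'u)
      \<Rightarrow> nat \<Rightarrow> (nat \<Rightarrow> real^'p) \<Rightarrow> real^'x^'x" where
  "closed_loop A B K k p = A (p k) + B ** K k p"

definition poly_Q_stabilizable ::
    "(real^'p) set \<Rightarrow> nat \<Rightarrow> (nat \<Rightarrow> real^'p \<Rightarrow> real)
      \<Rightarrow> (real^'p \<Rightarrow> real^'x^'x) \<Rightarrow> real^'u^'x \<Rightarrow> bool" where
  "poly_Q_stabilizable \<PP> N \<xi> A B \<longleftrightarrow> (\<exists>K. poly_QS \<PP> N \<xi> (closed_loop A B K))"

end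

theory Submission
  imports Defs
begin

text \<open>By a Schur complement and convexity in \<open>j\<close>, the matrix inequality gives
  \<open>X\<^sub>i + X\<^sub>i\<^sup>T - X\<^sub>i\<^sup>T P(\<sigma>) X\<^sub>i - A\<^sub>i S\<^sub>i A\<^sub>i\<^sup>T + B B\<^sup>T \<succ> 0\<close>, and Young's inequality
  \<open>X\<^sub>i + X\<^sub>i\<^sup>T - X\<^sub>i\<^sup>T P(\<sigma>) X\<^sub>i \<preceq> S(\<sigma>)\<close> removes \<open>X\<^sub>i\<close>: with \<open>W = S(\<sigma>) + B B\<^sup>T\<close>,
  \<open>(1 + e) A\<^sub>i S\<^sub>i A\<^sub>i\<^sup>T \<preceq> W\<close> for some \<open>e > 0\<close> common to all vertices.
  A second use of Young's inequality makes this
  \<open>2 y \<bullet> A\<^sub>i x \<le> y \<bullet> W y + x \<bullet> P\<^sub>i x / (1 + e)\<close>, which is affine in \<open>(A\<^sub>i, P\<^sub>i)\<close> and hence passes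
  to \<open>(A(\<pi>), P(\<pi>))\<close>. At \<open>y = W\<^sup>-\<^sup>1 A(\<pi>) x\<close> it bounds the Lyapunov function at the next
  step by \<open>V(\<pi>, x) / (1 + e)\<close>.\<close>

section \<open>Symmetric and positive definite matrices\<close>

lemma inner_matrix_vector_transpose:
  fixes A :: "real^'n^'m"
  shows "x \<bullet> (A *v y) = (transpose A *v x) \<bullet> y"
  by (simp add: dot_lmul_matrix)

lemma sym_matrix_inner_commute:
  assumes "sym_matrix M"
  shows "x \<bullet> (M *v y) = y \<bullet> (M *v x)"
  using inner_matrix_vector_transpose[of x M y] assms
  by (simp only: sym_matrix_def inner_commute)

lemma sym_matrixI:
  assumes "\<And>x y. x \<bullet> (M *v y) = y \<bullet> (M *v x)"
  shows "sym_matrix M"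
proof -
  have "(transpose M *v x) \<bullet> y = (M *v x) \<bullet> y" for x y
    using assms[of x y] by (simp only: inner_matrix_vector_transpose[of x M y] inner_commute[of y])
  then have "transpose M *v x = M *v x" for x
    using vector_eq_rdot[of "transpose M *v x" "M *v x"] by blast
  then show ?thesis
    using matrix_eq[of "transpose M" M] unfolding sym_matrix_def by blast
qed

lemma pos_def_nonneg:
  assumes "pos_def M"
  shows "0 \<le> x \<bullet> (M *v x)"
proof (cases "x = 0")
  case False
  then have "0 < x \<bullet> (M *v x)"
    using assms unfolding pos_def_def by blast
  then show ?thesis
    by simp
qed simp

lemma pos_def_invertible:
  assumes "pos_def M"
  shows "invertible M"
proof -
  have "x = 0" if "M *v x = 0" for x
  proof (rule ccontr)
    assume "x \<noteq> 0"
    then have "0 < x \<bullet> (M *v x)"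
      using assms unfolding pos_def_def by blast
    with that show False
      by simp
  qed
  then show ?thesis
    by (simp add: invertible_left_inverse matrix_left_invertible_ker)
qed

lemma matrix_inv_vector_cancel:
  assumes "pos_def M"
  shows "M *v (matrix_inv M *v x) = x" "matrix_inv M *v (M *v x) = x"
proof -
  have "M ** matrix_inv M = mat 1 \<and> matrix_inv M ** M = mat 1"
    using pos_def_invertible[OF assms] unfolding matrix_inv_def invertible_def by (rule someI_ex)
  then show "M *v (matrix_inv M *v x) = x" "matrix_inv M *v (M *v x) = x"
    by (simp_all add: matrix_vector_mul_assoc)
qed

text \<open>The substitution \<open>x = M *v x'\<close> is a congruence between the two forms, so
  symmetry and positivity of \<open>M\<close> carry over to its inverse.\<close>

lemma pos_def_matrix_inv:
  assumes "pos_def M"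
  shows "pos_def (matrix_inv M)"
proof -
  let ?I = "matrix_inv M"
  have sym: "sym_matrix M"
    using assms by (simp add: pos_def_def)
  have inner: "x \<bullet> (?I *v y) = (?I *v x) \<bullet> (M *v (?I *v y))" for x y
  proof -
    have "(?I *v x) \<bullet> (M *v (?I *v y)) = (?I *v y) \<bullet> (M *v (?I *v x))"
      by (rule sym_matrix_inner_commute[OF sym])
    also have "\<dots> = (?I *v y) \<bullet> x"
      by (simp only: matrix_inv_vector_cancel[OF assms])
    finally show ?thesis
      by (simp only: inner_commute)
  qed
  have "sym_matrix ?I"
  proof (rule sym_matrixI)
    fix x y
    have "(?I *v x) \<bullet> (M *v (?I *v y)) = (?I *v y) \<bullet> (M *v (?I *v x))"
      by (rule sym_matrix_inner_commute[OF sym])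
    then show "x \<bullet> (?I *v y) = y \<bullet> (?I *v x)"
      by (simp only: inner[of x y] inner[of y x])
  qed
  moreover have "0 < x \<bullet> (?I *v x)" if "x \<noteq> 0" for x
  proof -
    have "?I *v x \<noteq> 0"
      using that matrix_inv_vector_cancel(1)[OF assms, of x] by (metis matrix_vector_mult_0_right)
    then have "0 < (?I *v x) \<bullet> (M *v (?I *v x))"
      using assms unfolding pos_def_def by blast
    then show ?thesis
      by (simp only: inner[of x x])
  qed
  ultimately show ?thesis
    unfolding pos_def_def by blast
qed

lemma inner_gram:
  fixes B :: "real^'u^'x"
  shows "x \<bullet> ((B ** transpose B) *v x) = (norm (transpose B *v x))\<^sup>2"
  by (simp only: matrix_vector_mul_assoc[symmetric] inner_matrix_vector_transpose[of x B]
      power2_norm_eq_inner)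

lemma pos_def_add_gram:
  fixes B :: "real^'u^'x"
  assumes "pos_def M"
  shows "pos_def (M + B ** transpose B)"
  unfolding pos_def_def
proof (intro conjI allI impI)
  have "transpose (M + B ** transpose B) = transpose M + transpose (B ** transpose B)"
    unfolding transpose_def vec_eq_iff by simp
  also have "transpose (B ** transpose B) = B ** transpose B"
    by (simp only: matrix_transpose_mul transpose_transpose)
  finally show "sym_matrix (M + B ** transpose B)"
    using assms by (simp only: pos_def_def sym_matrix_def)
next
  fix x :: "real^'x" assume "x \<noteq> 0"
  then have "0 < x \<bullet> (M *v x)"
    using assms unfolding pos_def_def by blast
  then show "0 < x \<bullet> ((M + B ** transpose B) *v x)"
    by (simp only: matrix_vector_mult_add_rdistrib inner_add_right inner_gram add_pos_nonneg zero_le_power2)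
qed

text \<open>Completing the square in \<open>v - M\<^sup>-\<^sup>1 x\<close>.\<close>

lemma pos_def_young:
  assumes "pos_def M"
  shows "2 * (v \<bullet> x) \<le> v \<bullet> (M *v v) + x \<bullet> (matrix_inv M *v x)"
proof -
  let ?w = "matrix_inv M *v x"
  have "0 \<le> (v - ?w) \<bullet> (M *v (v - ?w))"
    by (rule pos_def_nonneg[OF assms])
  also have "\<dots> = v \<bullet> (M *v v) - v \<bullet> (M *v ?w) - ?w \<bullet> (M *v v) + ?w \<bullet> (M *v ?w)"
    by (simp add: matrix_vector_mult_diff_distrib inner_diff_left inner_diff_right)
  also have "?w \<bullet> (M *v v) = v \<bullet> (M *v ?w)"
    using assms by (simp add: pos_def_def sym_matrix_inner_commute)
  finally show ?thesis
    by (simp add: matrix_inv_vector_cancel[OF assms] inner_commute)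
qed

section \<open>Quadratic form bounds, uniform constants and convex averaging\<close>

lemma pos_def_coercive:
  assumes "pos_def M"
  shows "\<exists>c>0. \<forall>x. c * (norm x)\<^sup>2 \<le> x \<bullet> (M *v x)"
proof -
  \<comment> \<open>The form attains its minimum on the compact unit sphere; homogeneity of degree
    two then carries the bound to every \<open>x\<close>.\<close>
  have "\<exists>c\<in>sphere 0 1. \<forall>y\<in>sphere 0 1. c \<bullet> (M *v c) \<le> y \<bullet> (M *v y)"
  proof (rule continuous_attains_inf)
    show "sphere (0 :: real^'a) 1 \<noteq> {}"
      by simp
    show "continuous_on (sphere 0 1) (\<lambda>y. y \<bullet> (M *v y))"
      by (intro continuous_intros)
  qed simp
  then obtain u where u: "norm u = 1" "\<And>y. norm y = 1 \<Longrightarrow> u \<bullet> (M *v u) \<le> y \<bullet> (M *v y)"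
    by auto
  have "u \<bullet> (M *v u) * (norm x)\<^sup>2 \<le> x \<bullet> (M *v x)" for x
  proof (cases "x = 0")
    case False
    then have "u \<bullet> (M *v u) \<le> (x /\<^sub>R norm x) \<bullet> (M *v (x /\<^sub>R norm x))"
      by (intro u(2)) simp
    also have "\<dots> = (x \<bullet> (M *v x)) / (norm x)\<^sup>2"
      by (simp only: matrix_vector_mult_scaleR inner_scaleR_left inner_scaleR_right
          divide_inverse power2_eq_square inverse_mult_distrib mult_ac)
    finally show ?thesis
      using False by (simp add: pos_le_divide_eq)
  qed simp
  moreover have "u \<noteq> 0"
    using u(1) by auto
  then have "0 < u \<bullet> (M *v u)"
    using assms by (simp add: pos_def_def)
  ultimately show ?thesis
    by blast
qed

lemma quadratic_form_bounded:
  fixes M :: "real^'n^'n"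
  shows "\<exists>c>0. \<forall>x. x \<bullet> (M *v x) \<le> c * (norm x)\<^sup>2"
proof -
  obtain c where c: "c > 0" "\<And>x. norm (M *v x) \<le> norm x * c"
    using bounded_linear.pos_bounded[OF matrix_vector_mul_bounded_linear[of M]] by blast
  have "x \<bullet> (M *v x) \<le> c * (norm x)\<^sup>2" for x
  proof -
    have "x \<bullet> (M *v x) \<le> norm x * norm (M *v x)"
      by (rule norm_cauchy_schwarz)
    also have "\<dots> \<le> norm x * (norm x * c)"
      by (intro mult_left_mono c) simp
    finally show ?thesis
      by (simp add: power2_eq_square mult_ac)
  qed
  with c(1) show ?thesis
    by blast
qed

text \<open>Turns constants found vertex by vertex into one common constant. Since
  \<open>Q i\<close> survives shrinking its constant, the minimum serves all indices.\<close>

lemma finite_uniform_pos: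
  assumes "finite I"
    and "\<And>i. i \<in> I \<Longrightarrow> \<exists>c>0. Q i c"
    and "\<And>i c d. \<lbrakk>i \<in> I; Q i c; 0 < d; d \<le> c\<rbrakk> \<Longrightarrow> Q i d"
  shows "\<exists>c>0::real. \<forall>i\<in>I. Q i c"
proof -
  obtain f where f: "\<And>i. i \<in> I \<Longrightarrow> 0 < f i \<and> Q i (f i)"
    using assms(2) by metis
  \<comment> \<open>Inserting 1 keeps the minimum meaningful and positive when \<open>I\<close> is
    empty.\<close>
  let ?c = "Min (insert 1 (f ` I))"
  have "0 < ?c"
    using assms(1) f by simp
  moreover have "Q i ?c" if "i \<in> I" for i
    using assms(1) that f by (intro assms(3)[of i "f i" ?c] \<open>0 < ?c\<close>) auto
  ultimately show ?thesis
    by blast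
qed

text \<open>The device for passing from vertices to parameters. Upper bounds are obtained from it by
  negating both sides.\<close>

lemma convex_sum_ge:
  fixes w f :: "'i \<Rightarrow> real"
  assumes "\<And>i. i \<in> I \<Longrightarrow> 0 \<le> w i" "sum w I = 1" "\<And>i. i \<in> I \<Longrightarrow> a \<le> f i"
  shows "a \<le> (\<Sum>i\<in>I. w i * f i)"
proof -
  have "a = (\<Sum>i\<in>I. w i * a)"
    by (simp add: assms(2) flip: sum_distrib_right)
  also have "\<dots> \<le> (\<Sum>i\<in>I. w i * f i)"
    by (intro sum_mono mult_left_mono assms)
  finally show ?thesis .
qed

section \<open>Parameter-dependent matrices\<close>

lemma inner_poly_comb:
  "x \<bullet> (poly_comb N \<xi> M \<pi> *v y) = (\<Sum>i\<in>{1..N}. \<xi> i \<pi> * (x \<bullet> (M i *v y)))"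
proof -
  have "(\<Sum>i\<in>I. \<xi> i \<pi> *\<^sub>R M i) *v y = (\<Sum>i\<in>I. \<xi> i \<pi> *\<^sub>R (M i *v y))" if "finite I" for I
    using that
    by (induction I rule: finite_induct)
      (simp_all add: matrix_vector_mult_add_rdistrib scaleR_matrix_vector_assoc)
  then show ?thesis
    by (simp add: poly_comb_def inner_sum_right)
qed

lemma pos_def_poly_comb:
  assumes "\<And>i. i \<in> {1..N} \<Longrightarrow> pos_def (M i)"
    and "\<And>i. i \<in> {1..N} \<Longrightarrow> 0 \<le> \<xi> i \<pi>" "(\<Sum>i\<in>{1..N}. \<xi> i \<pi>) = 1"
  shows "pos_def (poly_comb N \<xi> M \<pi>)"
  unfolding pos_def_def
proof (intro conjI allI impI)
  show "sym_matrix (poly_comb N \<xi> M \<pi>)"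
  proof (rule sym_matrixI)
    fix x y
    have "x \<bullet> (M i *v y) = y \<bullet> (M i *v x)" if "i \<in> {1..N}" for i
      using assms(1)[OF that] by (simp add: pos_def_def sym_matrix_inner_commute)
    then show "x \<bullet> (poly_comb N \<xi> M \<pi> *v y) = y \<bullet> (poly_comb N \<xi> M \<pi> *v x)"
      by (simp add: inner_poly_comb)
  qed
next
  fix x :: "real^'a" assume "x \<noteq> 0"
  let ?q = "\<lambda>i. x \<bullet> (M i *v x)"
  \<comment> \<open>Individual weights may vanish, so strictness is secured by a positive lower
    bound common to all vertices, which averaging preserves.\<close>
  have "\<exists>c>0. c \<le> ?q i" if "i \<in> {1..N}" for i
    using assms(1)[OF that] \<open>x \<noteq> 0\<close> unfolding pos_def_def by blast
  then have "\<exists>c>0. \<forall>i\<in>{1..N}. c \<le> ?q i"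
    by (intro finite_uniform_pos[of _ "\<lambda>i c. c \<le> ?q i"]) auto
  then obtain c where c: "c > 0" "\<And>i. i \<in> {1..N} \<Longrightarrow> c \<le> ?q i"
    by blast
  have "c \<le> (\<Sum>i\<in>{1..N}. \<xi> i \<pi> * ?q i)"
    using assms(2,3) c(2) by (intro convex_sum_ge)
  then show "0 < x \<bullet> (poly_comb N \<xi> M \<pi> *v x)"
    using c(1) by (simp only: inner_poly_comb)
qed

section \<open>Block matrices and the Schur complement\<close>

definition block_vector :: "real^'a \<Rightarrow> real^'b \<Rightarrow> real^('a + 'b)" where
  "block_vector y z = (\<chi> r. case r of Inl i \<Rightarrow> y $ i | Inr i \<Rightarrow> z $ i)"

lemma sum_UNIV_Plus:
  "(\<Sum>r\<in>UNIV. f r) = (\<Sum>i\<in>UNIV. f (Inl i)) + (\<Sum>i\<in>UNIV. f (Inr i))"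
  for f :: "'a::finite + 'b::finite \<Rightarrow> real"
  by (simp add: sum.Plus flip: UNIV_Plus_UNIV)

lemma inner_block_vector:
  "block_vector y z \<bullet> block_vector y' z' = y \<bullet> y' + z \<bullet> z'"
  by (simp add: inner_vec_def sum_UNIV_Plus block_vector_def)

lemma block_matrix_mult_block_vector:
  "block_matrix M11 M12 M21 M22 *v block_vector y z
    = block_vector (M11 *v y + M12 *v z) (M21 *v y + M22 *v z)"
  by (auto simp: vec_eq_iff matrix_vector_mult_def sum_UNIV_Plus block_vector_def block_matrix_def
      split: sum.split)

text \<open>Test the block form on vectors whose first block is zero.\<close>

lemma pos_def_block_lower_right:
  assumes "pos_def (block_matrix M (transpose X) X S)"
  shows "pos_def S"
  unfolding pos_def_def
proof (intro conjI allI impI)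
  show "sym_matrix S"
  proof (rule sym_matrixI)
    fix x y
    show "x \<bullet> (S *v y) = y \<bullet> (S *v x)"
      using sym_matrix_inner_commute[of "block_matrix M (transpose X) X S"
          "block_vector 0 x" "block_vector 0 y"] assms
      by (simp add: pos_def_def block_matrix_mult_block_vector inner_block_vector)
  qed
next
  fix z :: "real^'b" assume "z \<noteq> 0"
  then have "block_vector (0 :: real^'a) z \<noteq> 0"
    by (metis inner_block_vector inner_eq_zero_iff inner_zero_left add_0)
  then have "0 < block_vector 0 z \<bullet> (block_matrix M (transpose X) X S *v block_vector 0 z)"
    using assms by (simp add: pos_def_def)
  then show "0 < z \<bullet> (S *v z)"
    by (simp add: block_matrix_mult_block_vector inner_block_vector)
qed

text \<open>The quadratic form of the Schur complement, obtained by the choice \<open>z = - S\<^sup>-\<^sup>1 X y\<close>.\<close>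

lemma pos_def_block_schur:
  assumes "pos_def (block_matrix M (transpose X) X S)"
  shows "\<exists>c>0. \<forall>y. c * (norm y)\<^sup>2 \<le> y \<bullet> (M *v y) - (X *v y) \<bullet> (matrix_inv S *v (X *v y))"
proof -
  let ?L = "block_matrix M (transpose X) X S"
  obtain c where c: "c > 0" "\<And>x. c * (norm x)\<^sup>2 \<le> x \<bullet> (?L *v x)"
    using pos_def_coercive[OF assms] by blast
  have "c * (norm y)\<^sup>2 \<le> y \<bullet> (M *v y) - (X *v y) \<bullet> (matrix_inv S *v (X *v y))" for y
  proof -
    let ?z = "- (matrix_inv S *v (X *v y))"
    have Sz: "S *v ?z = - (X *v y)"
      using matrix_inv_vector_cancel(1)[OF pos_def_block_lower_right[OF assms], of "X *v y"]
      by (simp add: linear_neg[OF matrix_vector_mul_linear])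
    \<comment> \<open>The squared norm of the block vector is that of \<open>y\<close> plus that of
      \<open>?z\<close>; only the first summand is kept.\<close>
    have "c * (norm y)\<^sup>2 \<le> c * (norm (block_vector y ?z))\<^sup>2"
      using c(1) by (simp add: power2_norm_eq_inner inner_block_vector del: inner_minus_left inner_minus_right)
    also have "\<dots> \<le> block_vector y ?z \<bullet> (?L *v block_vector y ?z)"
      by (rule c)
    also have "\<dots> = y \<bullet> (M *v y) + y \<bullet> (transpose X *v ?z) + ?z \<bullet> (X *v y + S *v ?z)"
      by (simp only: block_matrix_mult_block_vector inner_block_vector inner_add_right)
    also have "y \<bullet> (transpose X *v ?z) = (X *v y) \<bullet> ?z"
      by (simp only: inner_matrix_vector_transpose transpose_transpose)
    finally show ?thesis
      unfolding Sz by simp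
  qed
  with c(1) show ?thesis
    by blast
qed


section \<open>Margin at the vertices and the closed-loop step\<close>

lemma quadratic_form_perturbation:
  fixes G :: "real^'x^'x"
  assumes "c > 0"
  shows "\<exists>e>0. \<forall>y. e * (y \<bullet> (G *v y)) \<le> c * (norm y)\<^sup>2"
proof -
  obtain d where d: "d > 0" "\<And>y. y \<bullet> (G *v y) \<le> d * (norm y)\<^sup>2"
    using quadratic_form_bounded by blast
  have "c / d * (y \<bullet> (G *v y)) \<le> c * (norm y)\<^sup>2" for y
    using mult_left_mono[OF d(2), of "c / d" y] d(1) assms by simp
  moreover have "c / d > 0"
    using d(1) assms by simp
  ultimately show ?thesis
    by blast
qed

text \<open>Strictness is kept as a multiplicative margin \<open>e\<close>, because this is the form that survives
  Young's inequality and yields a decay rate uniform in the parameter.\<close>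

lemma vertex_margin:
  fixes X A S Q :: "real^'x^'x" and B :: "real^'u^'x"
  assumes "pos_def (block_matrix
        (X + transpose X - A ** S ** transpose A + B ** transpose B) (transpose X) X Q)"
  shows "\<exists>e>0. \<forall>y. (1 + e) * ((transpose A *v y) \<bullet> (S *v (transpose A *v y)))
      \<le> 2 * ((X *v y) \<bullet> y) - (X *v y) \<bullet> (matrix_inv Q *v (X *v y)) + (norm (transpose B *v y))\<^sup>2"
proof -
  let ?M = "X + transpose X - A ** S ** transpose A + B ** transpose B"
  obtain c where c: "c > 0"
    "\<And>y. c * (norm y)\<^sup>2 \<le> y \<bullet> (?M *v y) - (X *v y) \<bullet> (matrix_inv Q *v (X *v y))"
    using pos_def_block_schur[OF assms] by blast
  \<comment> \<open>The strict Schur gap \<open>c\<close> pays for \<open>e\<close> extra copies of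
    the form of \<open>A ** S ** transpose A\<close>.\<close>
  obtain e where e: "e > 0" "\<And>y. e * (y \<bullet> ((A ** S ** transpose A) *v y)) \<le> c * (norm y)\<^sup>2"
    using quadratic_form_perturbation[OF c(1)] by blast
  have G: "y \<bullet> ((A ** S ** transpose A) *v y)
      = (transpose A *v y) \<bullet> (S *v (transpose A *v y))" for y
    by (simp only: matrix_vector_mul_assoc[symmetric] inner_matrix_vector_transpose[of y A])
  have "y \<bullet> (transpose X *v y) = (X *v y) \<bullet> y" for y
    by (simp only: inner_matrix_vector_transpose[of y "transpose X"] transpose_transpose)
  then have M: "y \<bullet> (?M *v y) = 2 * ((X *v y) \<bullet> y)
      - (transpose A *v y) \<bullet> (S *v (transpose A *v y)) + (norm (transpose B *v y))\<^sup>2" for y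
    unfolding matrix_vector_mult_add_rdistrib matrix_vector_mult_diff_rdistrib
      inner_add_right inner_diff_right G inner_gram
    by (simp only: inner_commute[of y "X *v y"])
  have "(1 + e) * ((transpose A *v y) \<bullet> (S *v (transpose A *v y)))
      \<le> 2 * ((X *v y) \<bullet> y) - (X *v y) \<bullet> (matrix_inv Q *v (X *v y)) + (norm (transpose B *v y))\<^sup>2" for y
    using c(2)[of y] e(2)[of y] unfolding M G distrib_right by linarith
  with e(1) show ?thesis
    by blast
qed

text \<open>With \<open>W = P\<^sup>-\<^sup>1 + B B\<^sup>T\<close> the closed-loop matrix \<open>A - B B\<^sup>T W\<^sup>-\<^sup>1 A\<close> is
  \<open>P\<^sup>-\<^sup>1 W\<^sup>-\<^sup>1 A\<close>, so with \<open>y = W\<^sup>-\<^sup>1 A x\<close> the Lyapunov function at the next step is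
  \<open>y \<bullet> P\<^sup>-\<^sup>1 y\<close>.\<close>

lemma closed_loop_value_le:
  fixes P A :: "real^'x^'x" and B :: "real^'u^'x" and x :: "real^'x"
  assumes P: "pos_def P"
  defines "W \<equiv> matrix_inv P + B ** transpose B"
  defines "y \<equiv> matrix_inv W *v (A *v x)"
  defines "z \<equiv> (A + B ** (- transpose B ** matrix_inv W ** A)) *v x"
  shows "z \<bullet> (P *v z) \<le> y \<bullet> (W *v y)" and "W *v y = A *v x"
proof -
  have W: "pos_def W"
    unfolding W_def by (intro pos_def_add_gram pos_def_matrix_inv P)
  show Wy: "W *v y = A *v x"
    unfolding y_def by (rule matrix_inv_vector_cancel(1)[OF W])
  have neg: "(- C) *v v = - (C *v v)" for C :: "real^'x^'u" and v
    by (simp add: matrix_vector_mult_def vec_eq_iff sum_negf)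
  have "z = A *v x - B *v (transpose B *v y)"
    unfolding z_def y_def
    by (simp only: matrix_vector_mult_add_rdistrib matrix_vector_mul_assoc[symmetric] neg
        linear_neg[OF matrix_vector_mul_linear] diff_conv_add_uminus)
  also have "\<dots> = W *v y - (B ** transpose B) *v y"
    by (simp only: Wy matrix_vector_mul_assoc)
  also have "\<dots> = matrix_inv P *v y"
    unfolding W_def matrix_vector_mult_add_rdistrib by simp
  finally have z: "z = matrix_inv P *v y" .
  have "z \<bullet> (P *v z) = y \<bullet> (matrix_inv P *v y)"
    unfolding z matrix_inv_vector_cancel(1)[OF P] by (rule inner_commute)
  \<comment> \<open>The discarded term is the squared norm of \<open>transpose B *v y\<close>, that
    is, of the control input up to sign.\<close>
  also have "\<dots> \<le> y \<bullet> (W *v y)"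
    unfolding W_def matrix_vector_mult_add_rdistrib inner_add_right inner_gram by simp
  finally show "z \<bullet> (P *v z) \<le> y \<bullet> (W *v y)" .
qed

text \<open>Apply the unscaled inequality to \<open>t *\<^sub>R v\<close> and divide by
  \<open>t\<close>. Taking \<open>t\<close> to be the margin factor \<open>1 + e\<close> leaves
  \<open>1 / (1 + e)\<close> on the \<open>x\<close> term, which becomes the decay factor.\<close>

lemma pos_def_young_scaled:
  assumes "pos_def M" "0 < t"
  shows "2 * (v \<bullet> x) \<le> t * (v \<bullet> (M *v v)) + x \<bullet> (matrix_inv M *v x) / t"
proof -
  have "t * (2 * (v \<bullet> x)) = 2 * ((t *\<^sub>R v) \<bullet> x)"
    by simp
  also have "\<dots> \<le> (t *\<^sub>R v) \<bullet> (M *v (t *\<^sub>R v)) + x \<bullet> (matrix_inv M *v x)"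
    by (rule pos_def_young[OF assms(1)])
  also have "\<dots> = t * (t * (v \<bullet> (M *v v)) + x \<bullet> (matrix_inv M *v x) / t)"
    using assms(2) by (simp add: matrix_vector_mult_scaleR distrib_left)
  finally show ?thesis
    using assms(2) by (simp only: mult_le_cancel_left_pos)
qed

section \<open>Poly-quadratic stability of the closed loop\<close>

theorem theorem3:
  fixes \<PP> :: "(real^'p) set"
    and A :: "real^'p \<Rightarrow> real^'x^'x"
    and B :: "real^'u^'x"
    and N :: nat
    and \<xi> :: "nat \<Rightarrow> real^'p \<Rightarrow> real"
    and Av Sv Xv Pv :: "nat \<Rightarrow> real^'x^'x"
    and P S :: "real^'p \<Rightarrow> real^'x^'x"
    and K :: "nat \<Rightarrow> (nat \<Rightarrow> real^'p) \<Rightarrow> real^'x^'u"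
  assumes "compact \<PP>"
    and "polytopic_with \<PP> A N \<xi> Av"
    and "\<And>i. i \<in> {1..N} \<Longrightarrow> sym_matrix (Sv i)"
    and "\<And>i. i \<in> {1..N} \<Longrightarrow> Pv i = matrix_inv (Sv i)"
    and "\<And>i j. i \<in> {1..N} \<Longrightarrow> j \<in> {1..N} \<Longrightarrow>
           pos_def (block_matrix
             (Xv i + transpose (Xv i) - Av i ** Sv i ** transpose (Av i) + B ** transpose B)
             (transpose (Xv i))
             (Xv i)
             (Sv j))"
    and "\<And>\<pi>. P \<pi> = poly_comb N \<xi> Pv \<pi>"
    and "\<And>\<pi>. S \<pi> = matrix_inv (P \<pi>)"
    and "\<And>k p. K k p =
           - transpose B ** matrix_inv (S (p (k + 1)) + B ** transpose B) ** A (p k)"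
  shows "poly_Q_stabilizable \<PP> N \<xi> A B
       \<and> poly_QS \<PP> N \<xi> (closed_loop A B K)
       \<and> poly_QLF \<PP> N \<xi> (closed_loop A B K) (\<lambda>\<pi> x. x \<bullet> (P \<pi> *v x))"
proof -
  let ?I = "{1..N}"
  have \<xi>: "\<And>i. i \<in> ?I \<Longrightarrow> 0 \<le> \<xi> i \<pi>" "(\<Sum>i\<in>?I. \<xi> i \<pi>) = 1" "A \<pi> = poly_comb N \<xi> Av \<pi>"
    if "\<pi> \<in> \<PP>" for \<pi>
    using assms(2) that unfolding polytopic_with_def by blast+
  \<comment> \<open>The diagonal case j = i suffices. Positivity makes
    \<open>matrix_inv (Sv i)\<close> a genuine inverse.\<close>
  have Sv: "pos_def (Sv i)" if "i \<in> ?I" for i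
    using pos_def_block_lower_right[OF assms(5)[OF that that]] .
  have Pv: "pos_def (Pv i)" if "i \<in> ?I" for i
    unfolding assms(4)[OF that] by (rule pos_def_matrix_inv[OF Sv[OF that]])
  have P: "pos_def (P \<pi>)" if "\<pi> \<in> \<PP>" for \<pi>
    unfolding assms(6) using \<xi>[OF that] Pv by (intro pos_def_poly_comb)
  have V: "x \<bullet> (P \<pi> *v x) = (\<Sum>i\<in>?I. \<xi> i \<pi> * (x \<bullet> (Pv i *v x)))" for \<pi> x
    unfolding assms(6) by (rule inner_poly_comb)

  let ?lo = "\<lambda>i c. \<forall>x. c * (norm x)\<^sup>2 \<le> x \<bullet> (Pv i *v x)"
  have "\<exists>a>0. \<forall>i\<in>?I. ?lo i a"
  proof (rule finite_uniform_pos[of ?I ?lo])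
    show "\<exists>c>0. ?lo i c" if "i \<in> ?I" for i
      by (rule pos_def_coercive[OF Pv[OF that]])
    show "?lo i d" if "?lo i c" "0 < d" "d \<le> c" for i c d
      using that by (meson mult_right_mono order_trans zero_le_power2)
  qed simp
  then obtain a1 where a1: "a1 > 0" "\<And>i x. i \<in> ?I \<Longrightarrow> a1 * (norm x)\<^sup>2 \<le> x \<bullet> (Pv i *v x)"
    by blast
  \<comment> \<open>The upper bound is written with the constant on the form, so that it survives
    shrinking the constant; later \<open>a2 = 1 / b\<close>. The factor 1 matches
    \<open>quadratic_form_perturbation\<close> with \<open>c = 1\<close>.\<close>
  let ?hi = "\<lambda>i c. \<forall>x. c * (x \<bullet> (Pv i *v x)) \<le> 1 * (norm x)\<^sup>2"
  have "\<exists>b>0. \<forall>i\<in>?I. ?hi i b"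
  proof (rule finite_uniform_pos[of ?I ?hi])
    show "\<exists>c>0. ?hi i c" for i
      by (rule quadratic_form_perturbation) simp
    show "?hi i d" if "i \<in> ?I" "?hi i c" "0 < d" "d \<le> c" for i c d
      using that pos_def_nonneg[OF Pv[OF that(1)]] by (meson mult_right_mono order_trans)
  qed simp
  then obtain b where b: "b > 0" "\<And>i x. i \<in> ?I \<Longrightarrow> b * (x \<bullet> (Pv i *v x)) \<le> (norm x)\<^sup>2"
    by auto

  let ?f = "\<lambda>i y. (transpose (Av i) *v y) \<bullet> (Sv i *v (transpose (Av i) *v y))"
  let ?g = "\<lambda>i j y. 2 * ((Xv i *v y) \<bullet> y) - (Xv i *v y) \<bullet> (matrix_inv (Sv j) *v (Xv i *v y))
      + (norm (transpose B *v y))\<^sup>2"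
  \<comment> \<open>Indexing by pairs yields a single \<open>e\<close> for all i and j at
    once.\<close>
  let ?mar = "\<lambda>(i, j) e. \<forall>y. (1 + e) * ?f i y \<le> ?g i j y"
  have "\<exists>e>0. \<forall>ij\<in>?I \<times> ?I. ?mar ij e"
  proof (rule finite_uniform_pos[of "?I \<times> ?I" ?mar])
    show "\<exists>c>0. ?mar ij c" if "ij \<in> ?I \<times> ?I" for ij
    proof -
      obtain i j where ij: "ij = (i, j)" "i \<in> ?I" "j \<in> ?I"
        using \<open>ij \<in> ?I \<times> ?I\<close> by blast
      show ?thesis
        unfolding ij(1) prod.case by (rule vertex_margin[OF assms(5)[OF ij(2,3)]])
    qed
    show "?mar ij d" if "ij \<in> ?I \<times> ?I" "?mar ij c" "0 < d" "d \<le> c" for ij c d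
    proof -
      obtain i j where ij: "ij = (i, j)" "i \<in> ?I" "j \<in> ?I"
        using \<open>ij \<in> ?I \<times> ?I\<close> by blast
      have "(1 + d) * ?f i y \<le> (1 + c) * ?f i y" for y
        using pos_def_nonneg[OF Sv[OF ij(2)]] that(4) by (intro mult_right_mono) auto
      then show ?thesis
        using that(2) unfolding ij(1) prod.case by (meson order_trans)
    qed
  qed simp
  then obtain e where e: "e > 0"
    "\<And>i j y. i \<in> ?I \<Longrightarrow> j \<in> ?I \<Longrightarrow> (1 + e) * ?f i y \<le> ?g i j y"
    by fast

  have vertex: "(1 + e) * ?f i y \<le> y \<bullet> ((S \<sigma> + B ** transpose B) *v y)"
    if "i \<in> ?I" "\<sigma> \<in> \<PP>" for i \<sigma> y
  proof -
    let ?w = "Xv i *v y"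
    \<comment> \<open>With i fixed, average over j using the weights at \<sigma>. Everything on the
      left is independent of j, and the right side becomes the form of
      \<open>P \<sigma>\<close>.\<close>
    have "(1 + e) * ?f i y - 2 * (?w \<bullet> y) - (norm (transpose B *v y))\<^sup>2
        \<le> (\<Sum>j\<in>?I. \<xi> j \<sigma> * - (?w \<bullet> (Pv j *v ?w)))"
    proof (rule convex_sum_ge)
      show "(1 + e) * ?f i y - 2 * (?w \<bullet> y) - (norm (transpose B *v y))\<^sup>2 \<le> - (?w \<bullet> (Pv j *v ?w))"
        if "j \<in> ?I" for j
        using e(2)[OF \<open>i \<in> ?I\<close> that, of y] unfolding assms(4)[OF that] by linarith
    qed (use \<xi>[OF that(2)] in auto)
    also have "\<dots> = - (?w \<bullet> (P \<sigma> *v ?w))"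
      by (simp only: V mult_minus_right sum_negf)
    \<comment> \<open>Young's inequality for \<open>P \<sigma>\<close>, whose inverse is
      \<open>S \<sigma>\<close>, eliminates \<open>Xv i\<close>.\<close>
    also have "\<dots> \<le> y \<bullet> (S \<sigma> *v y) - 2 * (?w \<bullet> y)"
      using pos_def_young[OF P[OF that(2)], of ?w y] unfolding assms(7) by linarith
    finally show ?thesis
      unfolding matrix_vector_mult_add_rdistrib inner_add_right inner_gram by linarith
  qed

  \<comment> \<open>Here \<pi> is the current parameter and \<sigma> the next one, which the gain
    uses through \<open>S \<sigma>\<close>.\<close>
  have decay: "z \<bullet> (P \<sigma> *v z) \<le> x \<bullet> (P \<pi> *v x) / (1 + e)"
    if "\<pi> \<in> \<PP>" "\<sigma> \<in> \<PP>"
      and z: "z = (A \<pi> + B ** (- transpose B ** matrix_inv (S \<sigma> + B ** transpose B) ** A \<pi>)) *v x"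
    for \<pi> \<sigma> x z
  proof -
    let ?W = "S \<sigma> + B ** transpose B"
    define y where "y = matrix_inv ?W *v (A \<pi> *v x)"
    have Wy: "?W *v y = A \<pi> *v x" and le: "z \<bullet> (P \<sigma> *v z) \<le> y \<bullet> (?W *v y)"
      using closed_loop_value_le[OF P[OF that(2)], where A = "A \<pi>" and B = B and x = x]
      unfolding y_def z assms(7) by auto
    \<comment> \<open>Average over i using the weights at \<pi>. This works because \<open>y\<close>
      is built from \<open>A \<pi>\<close> and does not vary with i.\<close>
    have "- (y \<bullet> (?W *v y)) \<le> (\<Sum>i\<in>?I. \<xi> i \<pi> * (x \<bullet> (Pv i *v x) / (1 + e) - 2 * (y \<bullet> (Av i *v x))))"
    proof (rule convex_sum_ge)
      fix i assume i: "i \<in> ?I"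
      have "2 * (y \<bullet> (Av i *v x)) \<le> (1 + e) * ?f i y + x \<bullet> (Pv i *v x) / (1 + e)"
        using pos_def_young_scaled[OF Sv[OF i], of "1 + e" "transpose (Av i) *v y" x] e(1)
        unfolding inner_matrix_vector_transpose[of y "Av i"] assms(4)[OF i] by linarith
      then show "- (y \<bullet> (?W *v y)) \<le> x \<bullet> (Pv i *v x) / (1 + e) - 2 * (y \<bullet> (Av i *v x))"
        using vertex[OF i that(2), of y] by linarith
    qed (use \<xi>[OF that(1)] in auto)
    also have "\<dots> = x \<bullet> (P \<pi> *v x) / (1 + e) - 2 * (y \<bullet> (A \<pi> *v x))"
      unfolding V \<xi>(3)[OF that(1)] inner_poly_comb
      by (simp add: right_diff_distrib sum_subtractf sum_distrib_left sum_divide_distrib mult.left_commute)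
    \<comment> \<open>By \<open>Wy\<close> the cross term is twice
      \<open>y \<bullet> (?W *v y)\<close>, so one copy remains, bounded by the scaled current
      value.\<close>
    finally show ?thesis
      using le unfolding Wy by linarith
  qed

  \<comment> \<open>Dividing by \<open>1 + e\<close> removes the fraction \<open>e / (1 + e)\<close>
    of the current value, which is at least \<open>a1\<close> times the squared norm.\<close>
  let ?a3 = "e / (1 + e) * a1"
  have lower: "a1 * (norm x)\<^sup>2 \<le> x \<bullet> (P \<pi> *v x)" if "\<pi> \<in> \<PP>" for \<pi> x
    unfolding V using \<xi>[OF that] a1(2) by (intro convex_sum_ge)
  have upper: "x \<bullet> (P \<pi> *v x) \<le> 1 / b * (norm x)\<^sup>2" if "\<pi> \<in> \<PP>" for \<pi> x
  proof -
    have "- (1 / b * (norm x)\<^sup>2) \<le> (\<Sum>i\<in>?I. \<xi> i \<pi> * - (x \<bullet> (Pv i *v x)))"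
    proof (rule convex_sum_ge)
      show "- (1 / b * (norm x)\<^sup>2) \<le> - (x \<bullet> (Pv i *v x))" if "i \<in> ?I" for i
        using b(1) b(2)[OF that, of x] by (simp add: pos_le_divide_eq mult.commute)
    qed (use \<xi>[OF that] in auto)
    also have "\<dots> = - (x \<bullet> (P \<pi> *v x))"
      by (simp only: V mult_minus_right sum_negf)
    finally show ?thesis
      by linarith
  qed
  have step: "(closed_loop A B K k p *v x) \<bullet> (P (p (k + 1)) *v (closed_loop A B K k p *v x))
      \<le> x \<bullet> (P (p k) *v x) - ?a3 * (norm x)\<^sup>2" if "p \<in> param_seqs \<PP>" for k p x
  proof -
    have p: "p k \<in> \<PP>" "p (k + 1) \<in> \<PP>"
      using that by (auto simp: param_seqs_def)
    have "(closed_loop A B K k p *v x) \<bullet> (P (p (k + 1)) *v (closed_loop A B K k p *v x))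
        \<le> x \<bullet> (P (p k) *v x) / (1 + e)"
      by (rule decay[OF p]) (simp only: closed_loop_def assms(8))
    also have "\<dots> = x \<bullet> (P (p k) *v x) - e / (1 + e) * (x \<bullet> (P (p k) *v x))"
      using e(1) by (simp add: field_simps)
    also have "\<dots> \<le> x \<bullet> (P (p k) *v x) - ?a3 * (norm x)\<^sup>2"
      using mult_left_mono[OF lower[OF p(1)], of "e / (1 + e)" x] e(1) by (simp add: mult.assoc)
    finally show ?thesis .
  qed
  have "poly_QLF \<PP> N \<xi> (closed_loop A B K) (\<lambda>\<pi> x. x \<bullet> (P \<pi> *v x))"
    unfolding poly_QLF_def
  proof (intro conjI)
    show "\<exists>Pv. (\<forall>i\<in>?I. sym_matrix (Pv i)) \<and>
        (\<forall>\<pi>\<in>\<PP>. \<forall>x. x \<bullet> (P \<pi> *v x) = x \<bullet> (poly_comb N \<xi> Pv \<pi> *v x))"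
      using Pv unfolding assms(6) pos_def_def by blast
    show "\<exists>a1>0. \<exists>a2>0. \<exists>a3>0.
        (\<forall>\<pi>\<in>\<PP>. \<forall>x. a1 * (norm x)\<^sup>2 \<le> x \<bullet> (P \<pi> *v x) \<and> x \<bullet> (P \<pi> *v x) \<le> a2 * (norm x)\<^sup>2) \<and>
        (\<forall>k. \<forall>p\<in>param_seqs \<PP>. \<forall>x.
           (closed_loop A B K k p *v x) \<bullet> (P (p (k + 1)) *v (closed_loop A B K k p *v x))
           \<le> x \<bullet> (P (p k) *v x) - a3 * (norm x)\<^sup>2)"
    proof -
      have "0 < 1 / b" "0 < ?a3"
        using a1(1) b(1) e(1) by simp_all
      with a1(1) lower upper step show ?thesis
        by blast
    qed
  qed
  then show ?thesis
    unfolding poly_Q_stabilizable_def poly_QS_def by blast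
qed

end
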